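(* Let $S_n$ and $A_n$ be the symmetric group and the alternating group on $n$ symbols, respectively. Then $\Gamma_S(S_n)$ is a chordal graph if and only if $n=3$. On the other hand, $\Gamma_S(A_n)$ is chordal if and only if $n\le 4$.
   Context: For a group $G$ with identity $e$, the intersection subgroup graph $\Gamma_S(G)$ is the simple graph whose vertices are the non-trivial subgroups $H$ of $G$ such that $H\cap K=\{e\}$ for some non-trivial subgroup $K$ of $G$; two distinct vertices $H,K$ are adjacent if and only if $H\cap K=\{e\}$. The vertex set may be empty; the null graph is regarded as chordal. A graph is chordal if it contains no induced cycle of length greater than $3$.
   Formalization: The claim on S_n is stated only for n ≥ 3: for n ≤ 2 the graph Γ_S(S_n) is null, hence chordal by the stated convention, so "chordal if and only if n = 3" fails there. *)

theory Defs
  imports "HOL-Algebra.Sym_Groups" "Graph_Theory.Graph_Theory"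
begin

text \<open>
  Simple graphs are represented as in \<^theory>\<open>Graph_Theory.Pair_Digraph\<close>: a set of vertices together
  with a symmetric, irreflexive set of arcs, each edge giving two opposite arcs.
\<close>

definition nontrivial_subgroup :: "'a set \<Rightarrow> ('a, 'b) monoid_scheme \<Rightarrow> bool" where
  "nontrivial_subgroup H G \<longleftrightarrow> subgroup H G \<and> H \<noteq> {\<one>\<^bsub>G\<^esub>}"

definition isg_verts :: "('a, 'b) monoid_scheme \<Rightarrow> 'a set set" where
  "isg_verts G =
     {H. nontrivial_subgroup H G \<and> (\<exists>K. nontrivial_subgroup K G \<and> H \<inter> K = {\<one>\<^bsub>G\<^esub>})}"

definition intersection_subgroup_graph :: "('a, 'b) monoid_scheme \<Rightarrow> 'a set pair_pre_digraph" where
  "intersection_subgroup_graph G =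
     \<lparr> pverts = isg_verts G,
       parcs = {(H, K). H \<in> isg_verts G \<and> K \<in> isg_verts G \<and> H \<noteq> K \<and> H \<inter> K = {\<one>\<^bsub>G\<^esub>}} \<rparr>"

lemma pair_bidirected_digraph_intersection_subgroup_graph:
  "pair_bidirected_digraph (intersection_subgroup_graph G)"
proof
  show "symmetric (with_proj (intersection_subgroup_graph G))"
    unfolding symmetric_def with_proj_simps sym_def intersection_subgroup_graph_def
    by (auto simp: Int_commute)
qed (simp_all add: intersection_subgroup_graph_def split_beta)

text \<open>
  A cycle \<open>p\<close> is a closed list of arcs, traversing its edges in one direction only; its underlying
  simple graph also contains the opposite arcs. As \<open>p\<close> is closed, the tails of its arcs are
  all of its vertices.
\<close>

definition cycle_graph :: "('a \<times> 'a) awalk \<Rightarrow> 'a pair_pre_digraph" where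
  "cycle_graph p = \<lparr> pverts = fst ` set p, parcs = set p \<union> (set p)\<inverse> \<rparr>"

definition induced_cycle :: "'a pair_pre_digraph \<Rightarrow> ('a \<times> 'a) awalk \<Rightarrow> bool" where
  "induced_cycle G p \<longleftrightarrow>
     pre_digraph.cycle (with_proj G) p \<and>
     induced_subgraph (with_proj (cycle_graph p)) (with_proj G)"

definition chordal :: "'a pair_pre_digraph \<Rightarrow> bool" where
  "chordal G \<longleftrightarrow> \<not> (\<exists>p. induced_cycle G p \<and> length p > 3)"

end

theory Submission
  imports Defs "HOL-Algebra.Multiplicative_Group" "HOL-Computational_Algebra.Primes"
begin

text \<open>
  If all non-trivial proper subgroups of a finite group, except possibly one subgroup \<open>X\<close>, have
  prime order, then two distinct non-adjacent vertices always include \<open>X\<close>; but an induced cycle of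
  length at least four has two disjoint pairs of non-adjacent vertices. This settles \<open>S\<^sub>3\<close>,
  \<open>A\<^sub>n\<close> for \<open>n \<le> 3\<close>, and \<open>A\<^sub>4\<close>, where \<open>X\<close> is the Klein four-group, i.e. the complement of the
  eight 3-cycles. Conversely, two Klein four-groups \<open>{1, s, t, st}\<close> and \<open>{1, u, v, uv}\<close> with trivial
  intersection give the induced 4-cycle
  \<open>{1, s}\<close>, \<open>{1, u}\<close>, \<open>{1, s, t, st}\<close>, \<open>{1, u, v, uv}\<close>.
\<close>

section \<open>Chordality of intersection subgroup graphs\<close>

text \<open>The whole group meets every \<open>K\<close> in \<open>K\<close> itself, so it is never
  a vertex.\<close>

lemma isg_verts_proper:
  assumes "group G" "H \<in> isg_verts G"
  shows "subgroup H G" "H \<noteq> {\<one>\<^bsub>G\<^esub>}" "H \<noteq> carrier G"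
proof -
  show "subgroup H G" "H \<noteq> {\<one>\<^bsub>G\<^esub>}"
    using assms(2) by (auto simp: isg_verts_def nontrivial_subgroup_def)
  obtain K where "subgroup K G" "K \<noteq> {\<one>\<^bsub>G\<^esub>}" "H \<inter> K = {\<one>\<^bsub>G\<^esub>}"
    using assms(2) by (auto simp: isg_verts_def nontrivial_subgroup_def)
  then show "H \<noteq> carrier G"
    using subgroup.subset by blast
qed

text \<open>Take the first four vertices of the cycle. A chord between two opposite ones would, by
  inducedness, be an arc of \<open>p\<close> or the reverse of one; but each vertex is the tail of
  only one arc of \<open>p\<close>, and that arc leads to the next vertex.\<close>

lemma induced_cycle_two_nonadjacent_pairs:
  assumes "induced_cycle \<Gamma> p" "length p > 3"
  obtains a b c d where "distinct [a, b, c, d]" "{a, b, c, d} \<subseteq> pverts \<Gamma>"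
    "(a, c) \<notin> parcs \<Gamma>" "(b, d) \<notin> parcs \<Gamma>"
proof -
  obtain u where w: "pre_digraph.awalk (with_proj \<Gamma>) u p u"
    and dist: "distinct (tl (pawalk_verts u p))"
    and ind: "induced_subgraph (with_proj (cycle_graph p)) (with_proj \<Gamma>)"
    using assms(1)
    by (auto simp: induced_cycle_def pre_digraph.cycle_def awalk_verts_with_proj_eq)
  have cas: "pcas u p u"
    using w by (simp add: pre_digraph.awalk_def cas_with_proj_eq)
  obtain e0 e1 e2 e3 r where p: "p = e0 # e1 # e2 # e3 # r"
    using assms(2) by (auto simp: numeral_3_eq_3 less_iff_Suc_add length_Suc_conv)
  obtain a b c d x where e: "e0 = (a, b)" "e1 = (b, c)" "e2 = (c, d)" "e3 = (d, x)"
    and "a = u" and cas': "pcas x r a"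
    using cas by (cases e0; cases e1; cases e2; cases e3) (auto simp: p)
  \<comment> \<open>The vertices of a walk are the tails of its arcs plus the final vertex. In a
    closed walk, dropping the first vertex or the final one leaves the same multiset, so
    distinctness passes to the tails.\<close>
  have conv: "mset (pawalk_verts y q) = add_mset z (mset (map fst q))" if "pcas y q z" for y q z
    using that by (induction q arbitrary: y) auto
  have "mset (tl (pawalk_verts u p)) = mset (map fst p)"
    using conv[OF cas] by (simp add: p e \<open>a = u\<close>)
  then have tails: "distinct (map fst p)"
    using dist mset_eq_imp_distinct_iff by blast
  \<comment> \<open>If \<open>r\<close> is empty, the cycle has length four and
    \<open>x = a\<close>; otherwise \<open>x\<close> is the tail of the fifth arc.\<close>
  have x: "x \<noteq> b"
    using tails cas' by (cases r) (auto simp: p e)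
  have arcs: "(y, z) \<in> set p \<union> (set p)\<inverse>"
    if "(y, z) \<in> parcs \<Gamma>" "y \<in> fst ` set p" "z \<in> fst ` set p" for y z
    using ind that by (auto simp: induced_subgraph_def cycle_graph_def)
  have sub: "fst ` set p \<subseteq> pverts \<Gamma>"
    using ind by (auto simp: induced_subgraph_def subgraph_def cycle_graph_def)
  have uniq: "z = z'" if "(y, z) \<in> set p" "(y, z') \<in> set p" for y z z'
    using tails that by (metis eq_key_imp_eq_value)
  have mem: "(a, b) \<in> set p" "(b, c) \<in> set p" "(c, d) \<in> set p" "(d, x) \<in> set p"
    by (simp_all add: p e)
  have D: "distinct [a, b, c, d]"
    using tails by (auto simp: p e)
  show thesis
  proof (rule that[OF D])
    show "{a, b, c, d} \<subseteq> pverts \<Gamma>"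
      using sub by (auto simp: p e)
    have tl: "{a, b, c, d} \<subseteq> fst ` set p"
      by (auto simp: p e)
    show "(a, c) \<notin> parcs \<Gamma>"
      using arcs[of a c] uniq[OF mem(1), of c] uniq[OF mem(3), of a] D tl by auto
    show "(b, d) \<notin> parcs \<Gamma>"
      using arcs[of b d] uniq[OF mem(2), of d] uniq[OF mem(4), of b] D tl x by auto
  qed
qed

section \<open>A sufficient condition for chordality\<close>

lemma (in group) card_proper_subgroup:
  assumes "subgroup H G" "finite (carrier G)"
  shows "card H dvd order G" "H \<noteq> {\<one>} \<Longrightarrow> card H \<noteq> 1" "H \<noteq> carrier G \<Longrightarrow> card H \<noteq> order G"
proof -
  show "card H dvd order G"
    using lagrange[OF assms(1)] by (metis dvd_triv_right)
  show "card H \<noteq> 1" if "H \<noteq> {\<one>}"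
    using that subgroup.one_closed[OF assms(1)] by (metis card_1_singletonE singletonD)
  show "card H \<noteq> order G" if "H \<noteq> carrier G"
    using that card_subset_eq[OF assms(2) subgroup.subset[OF assms(1)]] by (auto simp: order_def)
qed

text \<open>If \<open>H\<close> has prime order, Lagrange inside \<open>H\<close> shows that
  \<open>H \<inter> K\<close> is trivial or all of \<open>H\<close>. Distinct vertices other than
  \<open>X\<close> are therefore adjacent, since otherwise each would contain the other; and
  \<open>X\<close> cannot lie in two disjoint non-adjacent pairs.\<close>

lemma chordal_if_prime_subgroups:
  assumes G: "group G" and fin: "finite (carrier G)"
    and prime: "\<And>H. \<lbrakk>subgroup H G; H \<noteq> {\<one>\<^bsub>G\<^esub>}; H \<noteq> carrier G; H \<noteq> X\<rbrakk> \<Longrightarrow> prime (card H)"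
  shows "chordal (intersection_subgroup_graph G)"
proof -
  interpret group G by fact
  have sub: "H \<subseteq> K" if "H \<in> isg_verts G" "K \<in> isg_verts G" "H \<noteq> X" "H \<inter> K \<noteq> {\<one>\<^bsub>G\<^esub>}" for H K
  proof -
    have H: "subgroup H G" "prime (card H)" and K: "subgroup K G"
      using isg_verts_proper[OF G] that prime by blast+
    have finH: "finite H"
      using H(1) fin finite_subset subgroup.subset by blast
    have "subgroup (H \<inter> K) (G\<lparr>carrier := H\<rparr>)"
      using H K by (simp add: subgroup_incl subgroups_Inter_pair)
    then have "card (H \<inter> K) dvd card H"
      using group.card_proper_subgroup(1)[OF subgroup_imp_group[OF H(1)]] finH
      by (simp add: order_def)
    then consider "card (H \<inter> K) = 1" | "card (H \<inter> K) = card H"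
      using H(2) by (auto simp: prime_nat_iff)
    then show ?thesis
    proof cases
      case 1
      then show ?thesis
        using that(4) H(1) K subgroup.one_closed by (metis IntI card_1_singletonE singletonD)
    next
      case 2
      then show ?thesis
        using card_subset_eq[OF finH, of "H \<inter> K"] by blast
    qed
  qed
  have adj: "(H, K) \<in> parcs (intersection_subgroup_graph G)"
    if "H \<in> isg_verts G" "K \<in> isg_verts G" "H \<noteq> K" "H \<noteq> X" "K \<noteq> X" for H K
    using that sub[of H K] sub[of K H]
    by (auto simp: intersection_subgroup_graph_def Int_commute)
  show ?thesis
    unfolding chordal_def
  proof clarify
    fix p assume "induced_cycle (intersection_subgroup_graph G) p" "length p > 3"
    then obtain a b c d where *: "distinct [a, b, c, d]"
      "{a, b, c, d} \<subseteq> isg_verts G"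
      "(a, c) \<notin> parcs (intersection_subgroup_graph G)"
      "(b, d) \<notin> parcs (intersection_subgroup_graph G)"
      by (rule induced_cycle_two_nonadjacent_pairs) (auto simp: intersection_subgroup_graph_def)
    then have "X \<in> {a, c}" "X \<in> {b, d}"
      using adj[of a c] adj[of b d] by auto
    with *(1) show False by auto
  qed
qed

section \<open>Induced 4-cycles from Klein four-groups\<close>

text \<open>The 4-cycle through \<open>A\<close>, \<open>B\<close>, \<open>C\<close>,
  \<open>D\<close> has no chord because opposite corners meet non-trivially. Each corner is a vertex
  because it meets a neighbour trivially, and neighbours differ because a non-trivial subgroup does
  not meet itself trivially.\<close>

lemma not_chordal_if_four_subgroups:
  assumes nt: "nontrivial_subgroup A G" "nontrivial_subgroup B G"
      "nontrivial_subgroup C G" "nontrivial_subgroup D G"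
    and adj: "A \<inter> B = {\<one>\<^bsub>G\<^esub>}" "B \<inter> C = {\<one>\<^bsub>G\<^esub>}" "C \<inter> D = {\<one>\<^bsub>G\<^esub>}" "D \<inter> A = {\<one>\<^bsub>G\<^esub>}"
    and nonadj: "A \<noteq> C" "B \<noteq> D" "A \<inter> C \<noteq> {\<one>\<^bsub>G\<^esub>}" "B \<inter> D \<noteq> {\<one>\<^bsub>G\<^esub>}"
  shows "\<not> chordal (intersection_subgroup_graph G)"
proof -
  let ?\<Gamma> = "intersection_subgroup_graph G"
  let ?p = "[(A, B), (B, C), (C, D), (D, A)]"
  interpret pair_bidirected_digraph ?\<Gamma>
    by (rule pair_bidirected_digraph_intersection_subgroup_graph)
  have verts: "{A, B, C, D} \<subseteq> isg_verts G"
    using nt adj unfolding isg_verts_def by (auto simp: Int_commute)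
  have "H \<noteq> K" if "nontrivial_subgroup H G" "H \<inter> K = {\<one>\<^bsub>G\<^esub>}" for H K
    using that by (auto simp: nontrivial_subgroup_def)
  then have neq: "A \<noteq> B" "B \<noteq> C" "C \<noteq> D" "D \<noteq> A"
    using nt adj by metis+
  then have dist: "distinct [A, B, C, D]"
    using neq nonadj by auto
  have arc: "(H, K) \<in> parcs ?\<Gamma> \<longleftrightarrow> H \<noteq> K \<and> H \<inter> K = {\<one>\<^bsub>G\<^esub>}" if "{H, K} \<subseteq> {A, B, C, D}" for H K
    using that verts by (auto simp: intersection_subgroup_graph_def)
  \<comment> \<open>\<open>cycle_graph\<close> holds both orientations of every edge, so the
    reversed arcs have to be found in the graph as well.\<close>
  have edges: "set ?p \<union> (set ?p)\<inverse> \<subseteq> parcs ?\<Gamma>"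
  proof -
    have "set ?p \<subseteq> parcs ?\<Gamma>"
      using dist adj neq by (simp add: arc)
    moreover have "(K, H) \<in> parcs ?\<Gamma>" if "(H, K) \<in> parcs ?\<Gamma>" for H K
      using that by (auto simp: intersection_subgroup_graph_def Int_commute)
    ultimately show ?thesis by blast
  qed
  have "cycle ?p"
    unfolding cycle_def awalk_def
    using verts dist edges by (intro exI[of _ A]) (simp add: intersection_subgroup_graph_def, blast)
  define H where "H = cycle_graph ?p"
  have H: "pverts H = {A, B, C, D}" "parcs H = set ?p \<union> (set ?p)\<inverse>"
    by (auto simp: H_def cycle_graph_def)
  have wf: "wf_digraph (with_proj H)"
    by unfold_locales (auto simp: H_def cycle_graph_def)
  have "(y, z) \<in> parcs H"
    if e: "(y, z) \<in> parcs ?\<Gamma>" "y \<in> {A, B, C, D}" "z \<in> {A, B, C, D}" for y z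
  proof -
    have "(A, C) \<notin> parcs ?\<Gamma>" "(C, A) \<notin> parcs ?\<Gamma>" "(B, D) \<notin> parcs ?\<Gamma>" "(D, B) \<notin> parcs ?\<Gamma>"
      using nonadj by (simp_all add: arc Int_commute)
    moreover have "y \<noteq> z"
      using pair_no_loops[OF e(1)] by simp
    ultimately show ?thesis
      using e unfolding H by (elim insertE emptyE) simp_all
  qed
  then have "{e \<in> parcs ?\<Gamma>. fst e \<in> pverts H \<and> snd e \<in> pverts H} \<subseteq> parcs H"
    unfolding H(1) by (intro subsetI) (metis (lifting) mem_Collect_eq prod.collapse)
  moreover have "parcs H \<subseteq> {e \<in> parcs ?\<Gamma>. fst e \<in> pverts H \<and> snd e \<in> pverts H}"
    using edges wf_digraph.tail_in_verts[OF wf] wf_digraph.head_in_verts[OF wf]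
    unfolding H(2)[symmetric] with_proj_simps by blast
  moreover have "pverts H \<subseteq> pverts ?\<Gamma>"
    using verts by (simp add: H intersection_subgroup_graph_def)
  ultimately have "induced_subgraph (with_proj H) (with_proj ?\<Gamma>)"
    unfolding induced_subgraph_def subgraph_def compatible_def
    using wf_digraph_axioms wf by auto
  with \<open>cycle ?p\<close> have "induced_cycle ?\<Gamma> ?p"
    by (simp add: induced_cycle_def H_def)
  moreover have "length ?p > 3"
    by simp
  ultimately show ?thesis
    unfolding chordal_def by blast
qed

text \<open>The case \<open>t = s\<close> collapses to \<open>{\<one>, s}\<close>, so the same lemma
  yields the two-element subgroups.\<close>

lemma (in group) subgroup_of_commuting_involutions:
  assumes st: "s \<in> carrier G" "t \<in> carrier G" and sq: "s \<otimes> s = \<one>" "t \<otimes> t = \<one>"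
    and comm: "t \<otimes> s = s \<otimes> t"
  shows "subgroup {\<one>, s, t, s \<otimes> t} G"
proof -
  \<comment> \<open>Rewrite rules for right-nested products: move \<open>s\<close> to the left of
    \<open>t\<close> and cancel squares.\<close>
  have r: "s \<otimes> (s \<otimes> x) = x" "t \<otimes> (t \<otimes> x) = x" "t \<otimes> (s \<otimes> x) = s \<otimes> (t \<otimes> x)"
    if "x \<in> carrier G" for x
    using that st sq comm by (metis m_assoc l_one)+
  have inv: "inv s = s" "inv t = t"
    using st sq inv_equality by auto
  then have "inv (s \<otimes> t) = s \<otimes> t"
    using st comm inv_mult_group by simp
  with inv show ?thesis
    by (intro subgroupI) (use st sq comm r in \<open>auto simp: m_assoc\<close>)
qed

text \<open>Opposite corners of the 4-cycle are nested and share \<open>s\<close> or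
  \<open>u\<close>; the distinctness of the seven elements makes neighbouring corners meet in the
  identity alone.\<close>

lemma not_chordal_if_commuting_involutions:
  assumes G: "group G" and carr: "{s, t, u, v} \<subseteq> carrier G"
    and sq: "s \<otimes>\<^bsub>G\<^esub> s = \<one>\<^bsub>G\<^esub>" "t \<otimes>\<^bsub>G\<^esub> t = \<one>\<^bsub>G\<^esub>" "u \<otimes>\<^bsub>G\<^esub> u = \<one>\<^bsub>G\<^esub>" "v \<otimes>\<^bsub>G\<^esub> v = \<one>\<^bsub>G\<^esub>"
    and comm: "t \<otimes>\<^bsub>G\<^esub> s = s \<otimes>\<^bsub>G\<^esub> t" "v \<otimes>\<^bsub>G\<^esub> u = u \<otimes>\<^bsub>G\<^esub> v"
    and dist: "distinct [\<one>\<^bsub>G\<^esub>, s, t, s \<otimes>\<^bsub>G\<^esub> t, u, v, u \<otimes>\<^bsub>G\<^esub> v]"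
  shows "\<not> chordal (intersection_subgroup_graph G)"
proof (rule not_chordal_if_four_subgroups)
  interpret group G by fact
  show "nontrivial_subgroup {\<one>\<^bsub>G\<^esub>, s} G"
    using subgroup_of_commuting_involutions[of s s] carr sq dist
    by (simp add: nontrivial_subgroup_def insert_commute)
  show "nontrivial_subgroup {\<one>\<^bsub>G\<^esub>, u} G"
    using subgroup_of_commuting_involutions[of u u] carr sq dist
    by (simp add: nontrivial_subgroup_def insert_commute)
  show "nontrivial_subgroup {\<one>\<^bsub>G\<^esub>, s, t, s \<otimes>\<^bsub>G\<^esub> t} G"
    using subgroup_of_commuting_involutions[of s t] carr sq comm dist
    by (simp add: nontrivial_subgroup_def)
  show "nontrivial_subgroup {\<one>\<^bsub>G\<^esub>, u, v, u \<otimes>\<^bsub>G\<^esub> v} G"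
    using subgroup_of_commuting_involutions[of u v] carr sq comm dist
    by (simp add: nontrivial_subgroup_def)
qed (use dist in \<open>auto dest: equalityD2\<close>)

section \<open>Symmetric and alternating groups\<close>

text \<open>The four-groups are generated by (1 2), (3 4) and by (1 3), (2 4). Their generators
  differ, and so do the products (1 2)(3 4) and (1 3)(2 4).\<close>

lemma not_chordal_sym_group:
  assumes "n \<ge> 4"
  shows "\<not> chordal (intersection_subgroup_graph (sym_group n))"
proof -
  let ?s = "transpose 1 2 :: nat \<Rightarrow> nat" and ?t = "transpose 3 4 :: nat \<Rightarrow> nat"
  let ?u = "transpose 1 3 :: nat \<Rightarrow> nat" and ?v = "transpose 2 4 :: nat \<Rightarrow> nat"
  \<comment> \<open>The images of 1 to 4 already tell the seven permutations apart, which reduces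
    inequality of functions to a computation on lists.\<close>
  have "distinct (map (\<lambda>p. map p [1, 2, 3, 4]) [id, ?s, ?t, ?s \<circ> ?t, ?u, ?v, ?u \<circ> ?v])"
    by (simp add: transpose_def)
  then have "distinct [id, ?s, ?t, ?s \<circ> ?t, ?u, ?v, ?u \<circ> ?v]"
    unfolding distinct_map by blast
  then show ?thesis
  proof (intro not_chordal_if_commuting_involutions[of _ ?s ?t ?u ?v], goal_cases)
    case 2
    then show ?case
      using assms by (auto simp: sym_group_carrier intro!: permutes_swap_id)
  qed (auto simp: sym_group_is_group sym_group_one sym_group_mult fun_eq_iff transpose_def)
qed

text \<open>The four-groups consist of the double transpositions on {1, 2, 3, 4} and on {1, 2, 3,
  5}, each with the identity. They meet trivially: the non-identity elements of the first move 4 and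
  fix 5, those of the second do the opposite.\<close>

lemma not_chordal_alt_group:
  assumes "n \<ge> 5"
  shows "\<not> chordal (intersection_subgroup_graph (alt_group n))"
proof -
  define s t u v :: "nat \<Rightarrow> nat" where
    "s = transpose 1 2 \<circ> transpose 3 4" and "t = transpose 1 3 \<circ> transpose 2 4" and
    "u = transpose 1 2 \<circ> transpose 3 5" and "v = transpose 1 3 \<circ> transpose 2 5"
  note defs = s_def t_def u_def v_def
  have even: "transpose a b \<circ> transpose c d \<in> carrier (alt_group n)"
    if "{a, b, c, d} \<subseteq> {1..n}" "a \<noteq> b" "c \<noteq> d" for a b c d
    using that unfolding alt_group_carrier
    by (auto intro!: permutes_compose permutes_swap_id
        simp: evenperm_comp evenperm_swap permutation_swap_id)
  have "distinct (map (\<lambda>p. map p [1, 2, 3, 4, 5]) [id, s, t, s \<circ> t, u, v, u \<circ> v])"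
    by (simp add: transpose_def defs)
  then have "distinct [id, s, t, s \<circ> t, u, v, u \<circ> v]"
    unfolding distinct_map by blast
  then show ?thesis
  proof (intro not_chordal_if_commuting_involutions[of _ s t u v], goal_cases)
    case 2
    then show ?case
      using assms even by (simp add: defs)
  qed (auto simp: alt_group_is_group alt_group_one alt_group_mult fun_eq_iff transpose_def defs)
qed

section \<open>Chordal cases\<close>

lemma chordal_sym_group_3: "chordal (intersection_subgroup_graph (sym_group 3))"
\<comment> \<open>No subgroup is empty, so this choice of \<open>X\<close> allows no
  exception.\<close>
proof (rule chordal_if_prime_subgroups[where X = "{}"])
  let ?G = "sym_group 3"
  interpret group ?G by (rule sym_group_is_group)
  show "group ?G" by (rule sym_group_is_group)
  have card: "order ?G = 6"
    by (simp add: order_def sym_group_card_carrier fact_numeral)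
  then show fin: "finite (carrier ?G)"
    by (simp add: order_def card_ge_0_finite)
  fix H assume H: "subgroup H ?G" "H \<noteq> {\<one>\<^bsub>?G\<^esub>}" "H \<noteq> carrier ?G"
  have dvd: "card H dvd 6" "card H \<noteq> 1" "card H \<noteq> 6"
    using card_proper_subgroup[OF H(1) fin] H card by auto
  then have "card H \<in> {0, 1, 2, 3, 4, 5, 6}"
    using dvd_imp_le[OF dvd(1)] by auto
  with dvd have "card H = 2 \<or> card H = 3"
    by auto
  then show "prime (card H)"
    by auto
qed

text \<open>A group of order 1 or 3 has no non-trivial proper subgroup, so the primality condition
  holds vacuously.\<close>

lemma chordal_alt_group_le_3:
  assumes "n \<le> 3"
  shows "chordal (intersection_subgroup_graph (alt_group n))"
proof (rule chordal_if_prime_subgroups[where X = "{}"])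
  let ?G = "alt_group n"
  interpret group ?G by (rule alt_group_is_group)
  show "group ?G" by (rule alt_group_is_group)
  have card: "order ?G = 1 \<or> order ?G = 3"
  \<comment> \<open>The order is \<open>n!/2\<close> only from \<open>n = 2\<close> on; below that
    the group is trivial.\<close>
  proof (cases "n \<ge> 2")
    case True
    then have "n = 2 \<or> n = 3"
      using assms by auto
    then show ?thesis
      using alt_group_card_carrier[OF True] by (auto simp: order_def fact_numeral)
  next
    case False
    then have "n = 0 \<or> n = 1"
      by auto
    then have "carrier ?G = {id}"
      by (auto simp: alt_group_carrier)
    then show ?thesis
      by (simp add: order_def)
  qed
  then show fin: "finite (carrier ?G)"
    by (auto simp: order_def intro: card_ge_0_finite)
  fix H assume H: "subgroup H ?G" "H \<noteq> {\<one>\<^bsub>?G\<^esub>}" "H \<noteq> carrier ?G"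
  have dvd: "card H dvd order ?G" "card H \<noteq> 1" "card H \<noteq> order ?G"
    using card_proper_subgroup[OF H(1) fin] H by auto
  moreover have "prime (3 :: nat)"
    by simp
  ultimately show "prime (card H)"
    using card by (auto simp: prime_nat_iff)
qed

text \<open>If \<open>x\<close> were outside \<open>H\<close>, the cosets \<open>H\<close> and
  \<open>xH\<close> would cover the group. A square of \<open>x\<close> in \<open>H\<close> gives
  \<open>x = x^4\<close> in \<open>H\<close>; a square of the form \<open>xh\<close> gives
  \<open>x = h\<close> in \<open>H\<close>.\<close>

lemma (in group) cube_root_of_one_in_index_two:
  assumes H: "subgroup H G" "2 * card H = order G" and fin: "finite (carrier G)"
    and x: "x \<in> carrier G" "x \<otimes> x \<otimes> x = \<one>"
  shows "x \<in> H"
proof (rule ccontr)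
  assume notin: "x \<notin> H"
  have sub: "H \<subseteq> carrier G"
    using H(1) subgroup.subset by blast
  have coset: "y \<in> H" if "h \<in> H" "y \<otimes> h \<in> H" "y \<in> carrier G" for y h
  proof -
    have "y = (y \<otimes> h) \<otimes> inv h"
      using that sub by (simp add: m_assoc subset_iff)
    then show ?thesis
      using that H(1) by (metis subgroup.m_closed subgroup.m_inv_closed)
  qed
  have disj: "H \<inter> (\<otimes>) x ` H = {}"
    using coset notin x by auto
  have "card ((\<otimes>) x ` H) = card H"
    using sub x by (intro card_image inj_onI) (auto simp: subset_iff)
  then have "card (H \<union> (\<otimes>) x ` H) = card (carrier G)"
    using disj H(2) finite_subset[OF sub fin] by (simp add: card_Un_disjoint order_def)
  then have "H \<union> (\<otimes>) x ` H = carrier G"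
    using sub x fin by (intro card_subset_eq) auto
  then consider "x \<otimes> x \<in> H" | h where "h \<in> H" "x \<otimes> x = x \<otimes> h"
    using x by blast
  then show False
  proof cases
    case 1
    have "(x \<otimes> x) \<otimes> (x \<otimes> x) = x"
      using x by (metis m_assoc m_closed r_one)
    then show False
      using 1 notin subgroup.m_closed[OF H(1)] by metis
  next
    case 2
    then show False
      using notin sub x by (auto simp: subset_iff)
  qed
qed

text \<open>Non-trivial proper subgroups have order 2, 3, 4 or 6. Order 6 is impossible, and a
  subgroup of order 4 avoids all 3-cycles, so by counting it is \<open>X\<close>.\<close>

lemma chordal_alt_group_4: "chordal (intersection_subgroup_graph (alt_group 4))"
proof -
  let ?G = "alt_group 4"
  \<comment> \<open>\<open>?c i j k\<close> is the 3-cycle sending \<open>i\<close> to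
    \<open>j\<close>, \<open>j\<close> to \<open>k\<close> and \<open>k\<close> to \<open>i\<close>;
    \<open>L\<close> lists both orientations for each three of the four symbols.\<close>
  let ?c = "\<lambda>i j k. transpose i j \<circ> transpose j k :: nat \<Rightarrow> nat"
  define L where "L = [?c 1 2 3, ?c 1 3 2, ?c 1 2 4, ?c 1 4 2, ?c 1 3 4, ?c 1 4 3, ?c 2 3 4, ?c 2 4 3]"
  define X where "X = carrier ?G - set L"
  interpret group ?G by (rule alt_group_is_group)
  have order: "order ?G = 12"
    using alt_group_card_carrier[of 4] by (simp add: order_def fact_numeral)
  then have fin: "finite (carrier ?G)"
    by (simp add: order_def card_ge_0_finite)
  have "distinct (map (\<lambda>p. map p [1, 2, 3, 4]) (id # L))"
    by (simp add: L_def transpose_def)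
  then have dist: "distinct (id # L)"
    unfolding distinct_map by blast
  then have cardL: "card (set L) = 8"
    using distinct_card[of L] by (simp add: L_def)
  have "?c i j k \<in> carrier ?G" if "{i, j, k} \<subseteq> {1..4}" "i \<noteq> j" "j \<noteq> k" for i j k
    using that unfolding alt_group_carrier
    by (auto intro!: permutes_compose permutes_swap_id
        simp: evenperm_comp evenperm_swap permutation_swap_id)
  then have L: "set L \<subseteq> carrier ?G"
    by (simp add: L_def)
  have cube: "x \<circ> x \<circ> x = id" if "x \<in> set L" for x
    using that unfolding L_def by (auto simp: fun_eq_iff transpose_def)
  have cardX: "card X = 4"
    using order L cardL fin by (simp add: X_def card_Diff_subset order_def)
  show ?thesis
  proof (rule chordal_if_prime_subgroups[where X = X])
    fix H assume H: "subgroup H ?G" "H \<noteq> {\<one>\<^bsub>?G\<^esub>}" "H \<noteq> carrier ?G" "H \<noteq> X"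
    have finH: "finite H"
      using H(1) fin finite_subset subgroup.subset by blast
    have dvd: "card H dvd 12" "card H \<noteq> 1" "card H \<noteq> 12"
      using card_proper_subgroup[OF H(1) fin] H order by auto
    have "card H \<noteq> 6"
    proof
      assume 6: "card H = 6"
      \<comment> \<open>a subgroup of index two contains every element of odd order, hence all eight 3-cycles\<close>
      have "set L \<subseteq> H"
        using cube_root_of_one_in_index_two[OF H(1) _ fin] L cube 6 order
        by (auto simp: alt_group_mult alt_group_one)
      then show False
        using card_mono[OF finH, of "set L"] cardL 6 by simp
    qed
    moreover have "card H \<noteq> 4"
    proof
      assume 4: "card H = 4"
      have "x \<notin> H" if "x \<in> set L" for x
      proof
        assume "x \<in> H"
        \<comment> \<open>The fourth power of \<open>x\<close> is trivial by Lagrange in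
          \<open>H\<close>, its cube because \<open>x\<close> is a 3-cycle; together they force
          \<open>x = id\<close>.\<close>
        then have "x [^]\<^bsub>?G\<^esub> (4 :: nat) = \<one>\<^bsub>?G\<^esub>"
          using group.pow_order_eq_1[OF subgroup_imp_group[OF H(1)], of x] 4
          by (simp add: order_def nat_pow_consistent[symmetric])
        then have "x \<circ> x \<circ> x \<circ> x = id"
          by (simp add: numeral_eq_Suc alt_group_mult alt_group_one)
        then have "x = id"
          using cube[OF that] by simp
        then show False
          using dist that by simp
      qed
      then have "H \<subseteq> X"
        using subgroup.subset[OF H(1)] by (auto simp: X_def)
      then have "H = X"
        using 4 cardX fin by (intro card_subset_eq) (auto simp: X_def)
      then show False
        using H(4) by simp
    qed
    moreover have "card H \<in> {0, 1, 2, 3, 4, 5, 6, 7, 8, 9, 10, 11, 12}"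
      using dvd_imp_le[OF dvd(1)] by (simp, presburger)
    ultimately have "card H = 2 \<or> card H = 3"
      using dvd by auto
    then show "prime (card H)"
      by auto
  qed (use fin alt_group_is_group in auto)
qed

text \<open>The symmetric groups with \<open>n \<le> 2\<close> have no non-trivial proper subgroup,
  so their graph is null and hence chordal; the guard \<open>n \<ge> 3\<close> sets them
  aside.\<close>

theorem theorem7p3:
  fixes n :: nat
  shows "(n \<ge> 3 \<longrightarrow> (chordal (intersection_subgroup_graph (sym_group n)) \<longleftrightarrow> n = 3)) \<and>
         (chordal (intersection_subgroup_graph (alt_group n)) \<longleftrightarrow> n \<le> 4)"
proof (intro conjI impI)
  assume "n \<ge> 3"
  then show "chordal (intersection_subgroup_graph (sym_group n)) \<longleftrightarrow> n = 3"
    using not_chordal_sym_group[of n] chordal_sym_group_3 by (cases "n = 3") auto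
next
  show "chordal (intersection_subgroup_graph (alt_group n)) \<longleftrightarrow> n \<le> 4"
    using not_chordal_alt_group[of n] chordal_alt_group_le_3[of n] chordal_alt_group_4
    by (cases "n = 4"; cases "n \<le> 3") auto
qed

end
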